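(* Let $r\ge2$ and $n_1,\dots,n_r$ be positive integers. Then $\mu_{\mathrm{int}}(K_{n_1,n_2,\dots,n_r})\le\left\lceil\frac{r}{2}\right\rceil$.
   Context: Graphs are finite and simple. $K_{n_1,\dots,n_r}$ is the complete $r$-partite graph whose vertex set is partitioned into independent sets $V_1,\dots,V_r$ with $|V_i|=n_i$, every vertex of $V_i$ being adjacent to every vertex of $V_j$ for $i\ne j$. A $k$-improper edge coloring of $G$ is a map $\alpha:E(G)\to\mathbb{N}$ such that at most $k$ edges with a common endpoint receive the same color; it is an improper interval coloring if at every vertex the colors on incident edges form a set of consecutive integers. $\mu_{\mathrm{int}}(G)$ is the smallest $k$ such that $G$ has a $k$-improper interval edge coloring. *)

theory Defs
  imports Complex_Main "HOL-Library.Disjoint_Sets"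
begin

text \<open>A graph is given by its vertex set and its set of edges, an edge being the two-element
  set of its endpoints.\<close>

definition finite_simple_graph :: "'a set \<Rightarrow> 'a set set \<Rightarrow> bool" where
  "finite_simple_graph V E \<longleftrightarrow> finite V \<and> (\<forall>e\<in>E. e \<subseteq> V \<and> card e = 2)"

definition incident_edges :: "'a set set \<Rightarrow> 'a \<Rightarrow> 'a set set" where
  "incident_edges E v = {e \<in> E. v \<in> e}"

text \<open>Colorings are total functions on sets of vertices; only their values on edges matter.\<close>

definition improper_edge_coloring ::
    "nat \<Rightarrow> 'a set \<Rightarrow> 'a set set \<Rightarrow> ('a set \<Rightarrow> nat) \<Rightarrow> bool" where
  "improper_edge_coloring k V E \<alpha> \<longleftrightarrow>
     (\<forall>v\<in>V. \<forall>c. card {e \<in> incident_edges E v. \<alpha> e = c} \<le> k)"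

text \<open>The interval \<open>{a..b}\<close> is empty if \<open>b < a\<close>, so isolated vertices impose no condition.\<close>

definition improper_interval_coloring ::
    "nat \<Rightarrow> 'a set \<Rightarrow> 'a set set \<Rightarrow> ('a set \<Rightarrow> nat) \<Rightarrow> bool" where
  "improper_interval_coloring k V E \<alpha> \<longleftrightarrow>
     improper_edge_coloring k V E \<alpha> \<and>
     (\<forall>v\<in>V. \<exists>a b. \<alpha> ` incident_edges E v = {a..b})"

definition mu_int :: "'a set \<Rightarrow> 'a set set \<Rightarrow> nat" where
  "mu_int V E = (LEAST k. \<exists>\<alpha>. improper_interval_coloring k V E \<alpha>)"

text \<open>\<open>(V, E)\<close> is (a copy of) the complete \<open>r\<close>-partite graph with parts of sizes
  \<open>n 1, \<dots>, n r\<close>.  Finiteness of the parts is required separately because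
  \<open>card\<close> is \<open>0\<close> on infinite sets.\<close>

definition complete_multipartite ::
    "nat \<Rightarrow> (nat \<Rightarrow> nat) \<Rightarrow> 'a set \<Rightarrow> 'a set set \<Rightarrow> bool" where
  "complete_multipartite r n V E \<longleftrightarrow>
     (\<exists>P. (\<forall>i\<in>{1..r}. finite (P i) \<and> card (P i) = n i) \<and>
          disjoint_family_on P {1..r} \<and>
          V = (\<Union>i\<in>{1..r}. P i) \<and>
          E = {{u, v} | u v. \<exists>i\<in>{1..r}. \<exists>j\<in>{1..r}. i \<noteq> j \<and> u \<in> P i \<and> v \<in> P j})"

text \<open>The set over which the minimum in \<open>mu_int\<close> is taken is never empty: a constant
  coloring is an improper interval coloring for \<open>k = card E\<close>.\<close>

lemma finite_simple_graph_finite_edges: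
  assumes "finite_simple_graph V E"
  shows "finite E"
  using assms unfolding finite_simple_graph_def
  by (intro finite_subset[of E "Pow V"]) auto

lemma improper_interval_coloring_exists:
  assumes "finite_simple_graph V E"
  shows "\<exists>\<alpha>. improper_interval_coloring (card E) V E \<alpha>"
proof
  have fin: "finite E"
    by (rule finite_simple_graph_finite_edges[OF assms])
  have "\<exists>a b. (\<lambda>_. 0) ` incident_edges E v = {a..b::nat}" for v
  proof (cases "incident_edges E v = {}")
    case True
    then have "(\<lambda>_. 0) ` incident_edges E v = {1..0::nat}"
      by simp
    then show ?thesis by blast
  next
    case False
    then have "(\<lambda>_. 0) ` incident_edges E v = {0..0::nat}"
      by auto
    then show ?thesis by blast
  qed
  moreover have "card {e \<in> incident_edges E v. (0::nat) = c} \<le> card E" for v c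
    by (intro card_mono[OF fin]) (auto simp: incident_edges_def)
  ultimately show "improper_interval_coloring (card E) V E (\<lambda>_. 0)"
    unfolding improper_interval_coloring_def improper_edge_coloring_def by blast
qed

lemma mu_int_attained:
  assumes "finite_simple_graph V E"
  shows "\<exists>\<alpha>. improper_interval_coloring (mu_int V E) V E \<alpha>"
  unfolding mu_int_def by (rule LeastI_ex) (use improper_interval_coloring_exists[OF assms] in blast)

lemma complete_multipartite_finite_simple_graph:
  assumes "complete_multipartite r n V E"
  shows "finite_simple_graph V E"
proof -
  obtain P where P: "\<forall>i\<in>{1..r}. finite (P i) \<and> card (P i) = n i"
    and disj: "disjoint_family_on P {1..r}"
    and V: "V = (\<Union>i\<in>{1..r}. P i)"
    and E: "E = {{u, v} | u v. \<exists>i\<in>{1..r}. \<exists>j\<in>{1..r}. i \<noteq> j \<and> u \<in> P i \<and> v \<in> P j}"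
    using assms unfolding complete_multipartite_def by blast
  have "finite V"
    using P V by auto
  moreover have "e \<subseteq> V \<and> card e = 2" if "e \<in> E" for e
  proof -
    obtain u v i j where e: "e = {u, v}" and ij: "i \<in> {1..r}" "j \<in> {1..r}" "i \<noteq> j"
      and uv: "u \<in> P i" "v \<in> P j"
      using \<open>e \<in> E\<close> unfolding E by blast
    have "P i \<inter> P j = {}"
      using disj ij by (rule disjoint_family_onD)
    then have "u \<noteq> v"
      using uv by blast
    then have "card e = 2"
      unfolding e by simp
    moreover have "e \<subseteq> V"
      unfolding e V using ij uv by blast
    ultimately show ?thesis by simp
  qed
  ultimately show ?thesis
    unfolding finite_simple_graph_def by blast
qed

lemma complete_multipartite_exists:
  "\<exists>(V :: (nat \<times> nat) set) E. complete_multipartite r n V E"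
proof -
  let ?P = "\<lambda>i. {i} \<times> {..<n i}"
  have "disjoint_family_on ?P {1..r}"
    by (auto simp: disjoint_family_on_def)
  moreover have "\<forall>i\<in>{1..r}. finite (?P i) \<and> card (?P i) = n i"
    by (simp add: card_cartesian_product_singleton)
  ultimately show ?thesis
    unfolding complete_multipartite_def
    by (intro exI[of _ ?P] exI conjI) (assumption | rule refl)+
qed

end

theory Submission
  imports Defs
begin

text \<open>Label the vertices of each part \<open>P i\<close> by \<open>0, \<dots>, n i - 1\<close> and give an edge between parts
  \<open>i\<close> and \<open>j\<close> the sum of the labels of its ends plus an offset \<open>d {i, j}\<close>.  Up to a translation, a
  vertex of \<open>P i\<close> then sees the integer intervals \<open>[d {i, j}, d {i, j} + n j)\<close> for \<open>j \<noteq> i\<close>, so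
  these have to cover an interval with multiplicity at most \<open>k = \<lceil>r / 2\<rceil>\<close>.

  Split the parts into a set \<open>A\<close> of \<open>k\<close> parts and a set \<open>B\<close> of at most \<open>k\<close> parts.  Let \<open>p\<close> be a
  largest part of \<open>A\<close>, let \<open>a\<^sub>1\<close> be its size and \<open>a\<^sub>2\<close> the second largest size in \<open>A\<close>, and fix \<open>q\<close> in
  \<open>B\<close>.  The offsets are \<open>0\<close> inside \<open>A\<close>, \<open>a\<^sub>1 + a\<^sub>2\<close> inside \<open>B\<close>, and \<open>a\<^sub>2\<close> between \<open>A\<close> and \<open>B\<close>, except
  that it is \<open>a\<^sub>1\<close> between \<open>A - {p}\<close> and \<open>q\<close>.  A part of \<open>A\<close> other than \<open>p\<close> sees only \<open>p\<close> and parts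
  of \<open>B - {q}\<close> on \<open>[a\<^sub>2, a\<^sub>1)\<close>, and this exception is what keeps the multiplicity there at
  most \<open>k\<close>.\<close>

text \<open>Lets a union be recognized as an interval by downward closure to \<open>s\<close>,
  without computing its right end.\<close>

lemma finite_nat_interval:
  fixes U :: "nat set"
  assumes "finite U" and "\<And>x. x \<in> U \<Longrightarrow> s \<le> x"
    and "\<And>x y. x \<in> U \<Longrightarrow> s \<le> y \<Longrightarrow> y < x \<Longrightarrow> y \<in> U"
  shows "\<exists>t. U = {s..<t}"
proof (cases "U = {}")
  case True
  then show ?thesis by (intro exI[of _ s]) simp
next
  case False
  have "U = {s..<Suc (Max U)}"
  proof (intro equalityI subsetI)
    fix x assume "x \<in> U"
    then show "x \<in> {s..<Suc (Max U)}"
      using Max_ge[OF assms(1)] assms(2) by (simp add: less_Suc_eq_le)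
  next
    fix x assume "x \<in> {s..<Suc (Max U)}"
    then show "x \<in> U"
      using assms(3)[OF Max_in[OF assms(1) False], of x] Max_in[OF assms(1) False]
      by (cases "x = Max U") auto
  qed
  then show ?thesis by blast
qed

section \<open>Colorings from vertex labels and offsets\<close>

lemma incident_edges_complete_multipartite:
  assumes "disjoint_family_on P I" and i: "i \<in> I" "v \<in> P i"
  shows "incident_edges {{u, v} | u v. \<exists>i\<in>I. \<exists>j\<in>I. i \<noteq> j \<and> u \<in> P i \<and> v \<in> P j} v =
    (\<lambda>u. {v, u}) ` (\<Union>j\<in>I - {i}. P j)"
proof -
  have uniq: "j = i" if "j \<in> I" "v \<in> P j" for j
    using disjoint_family_onD[OF assms(1) that(1) i(1)] that i by blast
  show ?thesis
  proof (intro equalityI subsetI)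
    fix e assume "e \<in> incident_edges {{u, v} | u v. \<exists>i\<in>I. \<exists>j\<in>I. i \<noteq> j \<and> u \<in> P i \<and> v \<in> P j} v"
    then obtain x y a b where "e = {x, y}" "v \<in> e" "a \<in> I" "b \<in> I" "a \<noteq> b" "x \<in> P a" "y \<in> P b"
      unfolding incident_edges_def by blast
    then have "v = x \<and> a = i \<or> v = y \<and> b = i" and e: "e = {x, y}" "e = {y, x}"
      using uniq by auto
    then show "e \<in> (\<lambda>u. {v, u}) ` (\<Union>j\<in>I - {i}. P j)"
      using \<open>a \<in> I\<close> \<open>b \<in> I\<close> \<open>a \<noteq> b\<close> \<open>x \<in> P a\<close> \<open>y \<in> P b\<close> by blast
  next
    fix e assume "e \<in> (\<lambda>u. {v, u}) ` (\<Union>j\<in>I - {i}. P j)"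
    then show "e \<in> incident_edges {{u, v} | u v. \<exists>i\<in>I. \<exists>j\<in>I. i \<noteq> j \<and> u \<in> P i \<and> v \<in> P j} v"
      unfolding incident_edges_def using i by blast
  qed
qed

text \<open>Labels run bijectively through \<open>{0..<n j}\<close> on \<open>P j\<close>, so the
  edges from a vertex of \<open>P i\<close> to \<open>P j\<close> take each color of a translate of
  \<open>{d {i, j}..<d {i, j} + n j}\<close> exactly once.\<close>

lemma improper_interval_coloring_from_offsets:
  fixes d :: "nat set \<Rightarrow> nat"
  assumes "complete_multipartite r n V E"
    and interval: "\<And>i. i \<in> {1..r} \<Longrightarrow>
      \<exists>a b. (\<Union>j\<in>{1..r} - {i}. {d {i, j}..<d {i, j} + n j}) = {a..<b}"
    and depth: "\<And>i x. i \<in> {1..r} \<Longrightarrow>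
      card {j \<in> {1..r} - {i}. x \<in> {d {i, j}..<d {i, j} + n j}} \<le> k"
  shows "\<exists>\<alpha>. improper_interval_coloring k V E \<alpha>"
proof -
  obtain P where P: "\<And>i. i \<in> {1..r} \<Longrightarrow> finite (P i) \<and> card (P i) = n i"
    and disj: "disjoint_family_on P {1..r}"
    and V: "V = (\<Union>i\<in>{1..r}. P i)"
    and E: "E = {{u, v} | u v. \<exists>i\<in>{1..r}. \<exists>j\<in>{1..r}. i \<noteq> j \<and> u \<in> P i \<and> v \<in> P j}"
    using assms(1) unfolding complete_multipartite_def by blast
  have "\<exists>g. bij_betw g (P i) {0..<n i}" if "i \<in> {1..r}" for i
    using ex_bij_betw_finite_nat[of "P i"] P[OF that] by simp
  then obtain g where g: "\<And>i. i \<in> {1..r} \<Longrightarrow> bij_betw (g i) (P i) {0..<n i}"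
    by metis
  define part where "part v = (THE i. i \<in> {1..r} \<and> v \<in> P i)" for v
  have part: "part v = i" if "i \<in> {1..r}" "v \<in> P i" for i v
    unfolding part_def using disjoint_family_onD[OF disj, of _ i] that
    by (intro the_equality) blast+
  define l where "l v = g (part v) v" for v
  have bij: "bij_betw l (P i) {0..<n i}" if "i \<in> {1..r}" for i
    using g[OF that] bij_betw_cong[of "P i" l "g i"] part[OF that] by (simp add: l_def)
  \<comment> \<open>Both terms depend only on the set \<open>e\<close>, so no orientation of edges
    is needed.\<close>
  define \<alpha> where "\<alpha> e = (\<Sum>v\<in>e. l v) + d (part ` e)" for e
  have \<alpha>: "\<alpha> {v, u} = l v + (d {i, j} + l u)"
    if "i \<in> {1..r}" "v \<in> P i" "j \<in> {1..r} - {i}" "u \<in> P j" for i j v u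
  proof -
    have "part v = i" "part u = j" "i \<noteq> j" using part that by auto
    then have "v \<noteq> u" by blast
    with \<open>part v = i\<close> \<open>part u = j\<close> show ?thesis by (simp add: \<alpha>_def)
  qed
  have "\<exists>a b. \<alpha> ` incident_edges E v = {a..b}"
    and "card {e \<in> incident_edges E v. \<alpha> e = c} \<le> k" if v: "v \<in> V" for v c
  proof -
    obtain i where i: "i \<in> {1..r}" "v \<in> P i" using v V by blast
    define J where "J = {1..r} - {i}"
    have inc: "incident_edges E v = (\<lambda>u. {v, u}) ` (\<Union>j\<in>J. P j)"
      unfolding E J_def by (rule incident_edges_complete_multipartite[OF disj i])
    have bijJ: "bij_betw l (P j) {0..<n j}" and \<alpha>J: "\<And>u. u \<in> P j \<Longrightarrow> \<alpha> {v, u} = l v + (d {i, j} + l u)"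
      if "j \<in> J" for j
      using bij \<alpha>[OF i] that by (auto simp: J_def)
    obtain a b where ab: "(\<Union>j\<in>J. {d {i, j}..<d {i, j} + n j}) = {a..<b}"
      using interval[OF i(1)] unfolding J_def by blast
    have "\<alpha> ` incident_edges E v = (\<Union>j\<in>J. (\<lambda>u. \<alpha> {v, u}) ` P j)"
      unfolding inc by blast
    also have "\<dots> = (\<Union>j\<in>J. (+) (l v) ` (+) (d {i, j}) ` l ` P j)"
      using \<alpha>J by (intro SUP_cong) (auto simp: image_image)
    also have "\<dots> = (\<Union>j\<in>J. (+) (l v) ` {d {i, j}..<d {i, j} + n j})"
      by (intro SUP_cong refl) (simp add: bij_betw_imp_surj_on[OF bijJ] add.commute)
    also have "\<dots> = (+) (l v) ` {a..<b}"
      unfolding ab[symmetric] by blast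
    also have "\<dots> = {l v + a..<l v + b}" by (simp add: add.commute)
    finally have col: "\<alpha> ` incident_edges E v = {l v + a..<l v + b}" .
    show "\<exists>a b. \<alpha> ` incident_edges E v = {a..b}"
    proof (cases "l v + a < l v + b")
      case True
      then have "{l v + a..<l v + b} = {l v + a..l v + b - 1}" by auto
      then show ?thesis using col by auto
    next
      case False
      then have "{l v + a..<l v + b} = {1..0}" by simp
      then show ?thesis using col by metis
    qed
    define W where "W = {u \<in> (\<Union>j\<in>J. P j). \<alpha> {v, u} = c}"
    have partW: "part u \<in> J \<and> u \<in> P (part u) \<and> c = l v + (d {i, part u} + l u)" if u: "u \<in> W" for u
    proof -
      obtain j where j: "j \<in> J" "u \<in> P j" using u by (auto simp: W_def)
      moreover from j have "part u = j" using part by (simp add: J_def)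
      ultimately show ?thesis using u \<alpha>J[OF j] by (simp add: W_def)
    qed
    have fin: "finite W" using P by (auto simp: W_def J_def)
    have "{e \<in> incident_edges E v. \<alpha> e = c} = (\<lambda>u. {v, u}) ` W"
      unfolding inc W_def by blast
    then have "card {e \<in> incident_edges E v. \<alpha> e = c} \<le> card W"
      using card_image_le[OF fin] by simp
    \<comment> \<open>Truncated subtraction is harmless: any \<open>u\<close> in \<open>W\<close>
      forces \<open>l v \<le> c\<close>. The color and the part determine the label of
      \<open>u\<close>, hence \<open>u\<close>.\<close>
    also have "\<dots> \<le> card {j \<in> J. c - l v \<in> {d {i, j}..<d {i, j} + n j}}"
    proof (rule card_inj_on_le)
      show "inj_on part W"
      proof (rule inj_onI)
        fix x y assume xy: "x \<in> W" "y \<in> W" "part x = part y"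
        then have "l x = l y" using partW by (metis add_left_cancel)
        then show "x = y"
          using xy partW bijJ unfolding bij_betw_def inj_on_def by metis
      qed
      show "part ` W \<subseteq> {j \<in> J. c - l v \<in> {d {i, j}..<d {i, j} + n j}}"
      proof safe
        fix u assume u: "u \<in> W"
        then have "l u < n (part u)"
          using partW[OF u] bijJ[of "part u"] by (auto simp: bij_betw_def)
        then show "c - l v \<in> {d {i, part u}..<d {i, part u} + n (part u)}" "part u \<in> J"
          using partW[OF u] by auto
      qed
      show "finite {j \<in> J. c - l v \<in> {d {i, j}..<d {i, j} + n j}}" by (simp add: J_def)
    qed
    also have "\<dots> \<le> k" unfolding J_def by (rule depth[OF i(1)])
    finally show "card {e \<in> incident_edges E v. \<alpha> e = c} \<le> k" .
  qed
  then show ?thesis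
    unfolding improper_interval_coloring_def improper_edge_coloring_def by blast
qed

section \<open>The offsets and their intervals\<close>

context
  fixes n :: "nat \<Rightarrow> nat" and A B :: "nat set" and p q a2 k :: nat
  assumes fin: "finite A" "finite B" and AB: "A \<inter> B = {}"
    and cards: "card A \<le> k" "card B \<le> k"
    and p: "p \<in> A" "\<And>j. j \<in> A \<Longrightarrow> n j \<le> n p"
    and q: "q \<in> B"
    and a2: "\<And>j. j \<in> A - {p} \<Longrightarrow> n j \<le> a2" "a2 \<le> n p"
      "a2 = 0 \<or> (\<exists>j\<in>A - {p}. n j = a2)"
begin

text \<open>For a pair with one index in \<open>A\<close> and one in \<open>B\<close>, the third
  test singles out the pairs joining \<open>A - {p}\<close> to \<open>q\<close>.\<close>

definition offset :: "nat set \<Rightarrow> nat" where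
  "offset S = (if S \<subseteq> A then 0 else if S \<subseteq> B then n p + a2
    else if p \<notin> S \<and> q \<in> S then n p else a2)"

lemma offset_simps:
  "i \<in> A \<Longrightarrow> j \<in> A \<Longrightarrow> offset {i, j} = 0"
  "i \<in> B \<Longrightarrow> j \<in> B \<Longrightarrow> offset {i, j} = n p + a2"
  "i \<in> A \<Longrightarrow> j \<in> B \<Longrightarrow> offset {i, j} = (if i \<noteq> p \<and> j = q then n p else a2)"
  "i \<in> B \<Longrightarrow> j \<in> A \<Longrightarrow> offset {i, j} = (if j \<noteq> p \<and> i = q then n p else a2)"
  using AB p q by (auto simp: offset_def)

text \<open>One interval starts at the minimum, and no other starts beyond its end. It comes from
  \<open>p\<close>, or, if \<open>i = p\<close>, from a part of size \<open>a2\<close> in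
  \<open>A - {p}\<close>; for \<open>a2 = 0\<close> none is needed there.\<close>

lemma offset_interval:
  assumes "i \<in> A \<union> B"
  shows "\<exists>a b. (\<Union>j\<in>A \<union> B - {i}. {offset {i, j}..<offset {i, j} + n j}) = {a..<b}"
    (is "\<exists>a b. ?U = {a..<b}")
proof -
  have finU: "finite ?U" using fin by simp
  consider (p) "i = p" | (A) "i \<in> A" "i \<noteq> p" | (B) "i \<in> B" using assms by blast
  then show ?thesis
  proof cases
    case p
    have "\<exists>t. ?U = {0..<t}"
    proof (rule finite_nat_interval[OF finU])
      fix x y assume x: "x \<in> ?U" and y: "y < x"
      then obtain j where j: "j \<in> A \<union> B" "j \<noteq> p" "offset {p, j} \<le> x" "x < offset {p, j} + n j"
        using p by auto
      show "y \<in> ?U"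
      proof (cases "y < a2")
        case True
        then obtain m where "m \<in> A - {p}" "a2 \<le> n m" using a2(3) by auto
        then show ?thesis
          using True p \<open>p \<in> A\<close> by (auto intro!: bexI[of _ m] simp: offset_simps)
      next
        case False
        then have "j \<in> B"
          using j y a2(1)[of j] \<open>p \<in> A\<close> by (auto simp: offset_simps)
        then show ?thesis
          using False j y p \<open>p \<in> A\<close> by (auto intro!: bexI[of _ j] simp: offset_simps)
      qed
    qed simp
    then show ?thesis by blast
  next
    case A
    have "\<exists>t. ?U = {0..<t}"
    proof (rule finite_nat_interval[OF finU])
      fix x y assume x: "x \<in> ?U" and y: "y < x"
      then obtain j where j: "j \<in> A \<union> B" "j \<noteq> i" "offset {i, j} \<le> x" "x < offset {i, j} + n j"
        by auto
      show "y \<in> ?U"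
      proof (cases "y < n p")
        case True
        then show ?thesis
          using A p(1) by (auto intro!: bexI[of _ p] simp: offset_simps)
      next
        case False
        then have "j \<in> B"
          using j y p(2)[of j] A by (auto simp: offset_simps)
        then have "offset {i, j} \<le> y"
          using False A a2(2) by (auto simp: offset_simps)
        then show ?thesis
          using j y by (auto intro!: bexI[of _ j])
      qed
    qed simp
    then show ?thesis by blast
  next
    case B
    then have "i \<noteq> p" using p(1) AB by blast
    have "\<exists>t. ?U = {a2..<t}"
    proof (rule finite_nat_interval[OF finU])
      fix x assume "x \<in> ?U"
      then obtain j where j: "j \<in> A \<union> B" "offset {i, j} \<le> x" by auto
      then show "a2 \<le> x"
        using B a2(2) by (auto simp: offset_simps split: if_splits)
    next
      fix x y assume x: "x \<in> ?U" and y: "a2 \<le> y" "y < x"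
      then obtain j where j: "j \<in> A \<union> B" "j \<noteq> i" "offset {i, j} \<le> x" "x < offset {i, j} + n j"
        by auto
      show "y \<in> ?U"
      proof (cases "y < n p + a2")
        case True
        then show ?thesis
          using y B p(1) \<open>i \<noteq> p\<close> by (auto intro!: bexI[of _ p] simp: offset_simps)
      next
        case False
        \<comment> \<open>Intervals of parts in \<open>A\<close> end by \<open>n p + a2\<close>:
          that of \<open>p\<close> starts at \<open>a2\<close>, and the others have length at most
          \<open>a2\<close> and start no later than \<open>n p\<close>.\<close>
        have "j \<in> B"
        proof (rule ccontr)
          assume "j \<notin> B"
          then have "j \<in> A" using j by blast
          then show False
            using False j y B p(2)[of j] a2(1)[of j]
            by (auto simp: offset_simps split: if_splits)
        qed
        then show ?thesis
          using False j y B by (auto intro!: bexI[of _ j] simp: offset_simps)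
      qed
    qed
    then show ?thesis by blast
  qed
qed

text \<open>The parts covering \<open>x\<close> all lie in \<open>A\<close> or all in
  \<open>B\<close>, except possibly for \<open>i\<close> in \<open>A - {p}\<close> and
  \<open>a2 \<le> x < n p\<close>.\<close>

lemma offset_depth:
  assumes "i \<in> A \<union> B"
  shows "card {j \<in> A \<union> B - {i}. x \<in> {offset {i, j}..<offset {i, j} + n j}} \<le> k"
    (is "card ?S \<le> k")
proof -
  have sub: "card ?S \<le> k" if "?S \<subseteq> T" "finite T" "card T \<le> k" for T
    using card_mono[OF that(2,1)] that(3) by simp
  consider (p) "i = p" | (A) "i \<in> A" "i \<noteq> p" | (B) "i \<in> B" using assms by blast
  then show ?thesis
  proof cases
    case p
    have "?S \<subseteq> A \<or> ?S \<subseteq> B"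
    proof (cases "x < a2")
      case True
      then show ?thesis using p \<open>p \<in> A\<close> by (auto simp: offset_simps)
    next
      case False
      have "j \<in> B" if "j \<in> ?S" for j
        using that False p \<open>p \<in> A\<close> a2(1)[of j] by (auto simp: offset_simps)
      then show ?thesis by blast
    qed
    then show ?thesis using sub fin cards by blast
  next
    case A
    consider "x < a2" | "a2 \<le> x" "x < n p" | "n p \<le> x" by linarith
    then show ?thesis
    proof cases
      case 1
      then have "?S \<subseteq> A" using A a2(2) by (auto simp: offset_simps split: if_splits)
      then show ?thesis using sub fin cards by blast
    next
      case 2
      \<comment> \<open>The interval of \<open>q\<close> starts only at \<open>n p\<close>, so
        \<open>p\<close> takes its place and the bound is still \<open>card B\<close>.\<close>
      have "j \<in> insert p (B - {q})" if "j \<in> ?S" for j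
        using that 2 A a2(1)[of j] by (auto simp: offset_simps split: if_splits)
      then have "?S \<subseteq> insert p (B - {q})" by blast
      moreover have "card (insert p (B - {q})) \<le> k"
        using fin q cards p(1) AB card_Suc_Diff1[OF fin(2) q] card_insert_le_m1[of k "B - {q}" p]
        by (auto simp: card_insert_if)
      ultimately show ?thesis using sub fin by blast
    next
      case 3
      have "j \<in> B" if "j \<in> ?S" for j
        using that 3 A p(2)[of j] by (auto simp: offset_simps)
      then have "?S \<subseteq> B" by blast
      then show ?thesis using sub fin cards by blast
    qed
  next
    case B
    have "?S \<subseteq> A \<or> ?S \<subseteq> B"
    proof (cases "x < n p + a2")
      case True
      then show ?thesis using B by (auto simp: offset_simps)
    next
      case False
      have "j \<notin> A" if "j \<in> ?S" for j
        using that False B AB p(2)[of j] a2(1)[of j] by (auto simp: offset_simps split: if_splits)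
      then show ?thesis by blast
    qed
    then show ?thesis using sub fin cards by blast
  qed
qed

end

section \<open>Choice of the two halves and conclusion\<close>

lemma complete_multipartite_improper_interval_coloring:
  assumes "r \<ge> 2" and "complete_multipartite r n V E"
  shows "\<exists>\<alpha>. improper_interval_coloring ((r + 1) div 2) V E \<alpha>"
proof -
  define k where "k = (r + 1) div 2"
  define A where "A = {1..k}"
  define B where "B = {k + 1..r}"
  \<comment> \<open>The index \<open>r\<close> serves as \<open>q\<close>; it lies in
    \<open>B\<close> because \<open>r \<ge> 2\<close> gives \<open>k < r\<close>.\<close>
  have I: "{1..r} = A \<union> B" and disj: "A \<inter> B = {}" and q: "r \<in> B" and ne: "A \<noteq> {}"
    using assms(1) by (auto simp: A_def B_def k_def)
  have fin: "finite A" "finite B" and cards: "card A \<le> k" "card B \<le> k"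
    by (auto simp: A_def B_def k_def)
  have "Max (n ` A) \<in> n ` A" using fin ne by simp
  then obtain p where p: "p \<in> A" "n p = Max (n ` A)" by auto
  have pmax: "n j \<le> n p" if "j \<in> A" for j using p(2) that fin by simp
  \<comment> \<open>the element \<open>0\<close> covers the case \<open>r = 2\<close>, where \<open>A = {p}\<close>\<close>
  define a2 where "a2 = Max (insert 0 (n ` (A - {p})))"
  have "a2 \<in> insert 0 (n ` (A - {p}))" unfolding a2_def using fin by (intro Max_in) auto
  then have a2: "a2 = 0 \<or> (\<exists>j\<in>A - {p}. n j = a2)" "a2 \<le> n p" using pmax by auto
  have a2max: "n j \<le> a2" if "j \<in> A - {p}" for j
    unfolding a2_def using that fin by (intro Max_ge) auto
  note ctxt = fin disj cards p(1) pmax q a2max a2(2,1)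
  show ?thesis
    unfolding k_def[symmetric]
    by (rule improper_interval_coloring_from_offsets[OF assms(2), where d = "offset n A B p r a2"])
      (simp_all only: I offset_interval[OF ctxt] offset_depth[OF ctxt])
qed

theorem theorem30:
  fixes r :: nat and n :: "nat \<Rightarrow> nat" and V :: "'a set" and E :: "'a set set"
  assumes "r \<ge> 2"
    and "\<And>i. i \<in> {1..r} \<Longrightarrow> n i > 0"
    and "complete_multipartite r n V E"
  shows "int (mu_int V E) \<le> \<lceil>real r / 2\<rceil>"
proof -
  have "mu_int V E \<le> (r + 1) div 2"
    unfolding mu_int_def
    by (rule Least_le) (rule complete_multipartite_improper_interval_coloring[OF assms(1,3)])
  moreover have "int ((r + 1) div 2) \<le> \<lceil>real r / 2\<rceil>" by linarith
  ultimately show ?thesis by linarith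
qed

end
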